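(* Let $X=M$ and $Y=M\circ Q$, as functions $\mathbb{Z}_2\to[0,2]$. Then $$(X,Y)(2r)=\tfrac12\,(X,Y)(r)\qquad\text{for all } r\in\mathbb{Z}_2,$$ and, for every integer $k\ge2$ and every $r\in\mathbb{Z}_2$ with $r\equiv\alpha_k\pmod{2^k}$, $$(X,Y)(2r+1)=\tfrac12\,(X,Y)(r)+(1,\,1-2^{-k}).$$ (These are self-affine relationships of the set $\{(X(r),Y(r)):r\in\mathbb{Z}_2\}\subset\mathbb{R}^2$.)
   Context: The $3x+1$ map $T:\mathbb{Z}_2\to\mathbb{Z}_2$ is $T(x)=\frac{3x+1}{2}$ if $x$ is odd, $T(x)=\frac x2$ if $x$ is even. For $x\in\mathbb{Z}_2$, the parity sequence of $x$ is $(s_0,s_1,s_2,\ldots)$ with $s_k\in\{0,1\}$, $s_k\equiv T^k(x)\pmod 2$, and $Q:\mathbb{Z}_2\to\mathbb{Z}_2$ is $Q(x)=\sum_{k=0}^\infty s_k2^k$. The map $M:\mathbb{Z}_2\to[0,2]$ is $M\left(\sum_{k=0}^\infty r_k2^k\right)=\sum_{k=0}^\infty r_k2^{-k}$ (with $r_k\in\{0,1\}$). For $k\ge2$, $\alpha_k\in\{0,\ldots,2^k-1\}$ is the residue of $-1-(-2)^{k-2}$ modulo $2^k$. Notation: $(X,Y)(r)=(X(r),Y(r))$. *)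

theory Defs
  imports "HOL-Analysis.Analysis"
begin

text \<open>
  The ring of 2-adic integers as the inverse limit of the rings of integers modulo $2^n$.
  The compatibility condition forces \<open>a n\<close> to be the canonical residue in \<open>{0..<2 ^ n}\<close>.
\<close>

typedef z2 = "{a :: nat \<Rightarrow> int. \<forall>n. a n = a (Suc n) mod 2 ^ n}"
  morphisms res Abs_z2
  by (rule exI [of _ "\<lambda>n. 0"]) simp

setup_lifting type_definition_z2

lemma mod_pow2_Suc_mod: "(x mod 2 ^ Suc n) mod 2 ^ n = x mod (2 ^ n :: int)"
  by (rule mod_mod_cancel) (simp add: le_imp_power_dvd)

lemma compatible_binop:
  assumes a: "\<And>n. a n = a (Suc n) mod 2 ^ n" and b: "\<And>n. b n = b (Suc n) mod (2 ^ n :: int)"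
    and f: "\<And>x y m. f (x mod m) (y mod m) mod m = f x y mod (m :: int)"
  shows "f (a n) (b n) mod 2 ^ n = f (a (Suc n)) (b (Suc n)) mod 2 ^ Suc n mod 2 ^ n"
proof -
  have "f (a n) (b n) mod 2 ^ n = f (a (Suc n) mod 2 ^ n) (b (Suc n) mod 2 ^ n) mod 2 ^ n"
    using a [of n] b [of n] by argo
  then show ?thesis by (simp only: f mod_pow2_Suc_mod)
qed

lemma z2_eqI: "(\<And>n. res x n = res y n) \<Longrightarrow> x = y"
  by (metis res_inject ext)

lemma res_Suc: "res x (Suc n) mod 2 ^ n = res x n"
  using res [of x] by (metis (mono_tags, lifting) mem_Collect_eq)

lemma res_mod [simp]: "res x n mod 2 ^ n = res x n"
  by (metis res_Suc mod_mod_trivial)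

lemma res_bounds: "0 \<le> res x n" "res x n < 2 ^ n"
  using pos_mod_sign [of "2 ^ n" "res x n"] pos_mod_bound [of "2 ^ n" "res x n"]
  by (simp_all only: res_mod zero_less_power zero_less_numeral)

lemma res_0 [simp]: "res x 0 = 0"
  using res_bounds [of x 0] by simp

instantiation z2 :: comm_ring_1
begin

lift_definition zero_z2 :: z2 is "\<lambda>n. 0 mod 2 ^ n"
  by (simp only: mod_pow2_Suc_mod)
lift_definition one_z2 :: z2 is "\<lambda>n. 1 mod 2 ^ n"
  by (simp only: mod_pow2_Suc_mod)
lift_definition plus_z2 :: "z2 \<Rightarrow> z2 \<Rightarrow> z2" is "\<lambda>a b n. (a n + b n) mod 2 ^ n"
  by (rule compatible_binop [where f = "\<lambda>x y. x + y"]) (assumption | rule mod_add_eq)+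
lift_definition times_z2 :: "z2 \<Rightarrow> z2 \<Rightarrow> z2" is "\<lambda>a b n. (a n * b n) mod 2 ^ n"
  by (rule compatible_binop [where f = "\<lambda>x y. x * y"]) (assumption | rule mod_mult_eq)+
lift_definition minus_z2 :: "z2 \<Rightarrow> z2 \<Rightarrow> z2" is "\<lambda>a b n. (a n - b n) mod 2 ^ n"
  by (rule compatible_binop [where f = "\<lambda>x y. x - y"]) (assumption | rule mod_diff_eq)+
lift_definition uminus_z2 :: "z2 \<Rightarrow> z2" is "\<lambda>a n. (- a n) mod 2 ^ n"
  by (rule compatible_binop [where f = "\<lambda>x y. - x"]) (assumption | rule mod_minus_eq)+

lemmas res_ring = zero_z2.rep_eq one_z2.rep_eq plus_z2.rep_eq times_z2.rep_eq
  minus_z2.rep_eq uminus_z2.rep_eq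

instance
proof
  fix a b c :: z2
  show "a * b * c = a * (b * c)"
    by (rule z2_eqI) (simp add: res_ring mod_mult_left_eq mod_mult_right_eq mult.assoc)
  show "a * b = b * a"
    by (rule z2_eqI) (simp add: res_ring mult.commute)
  show "1 * a = a"
    by (rule z2_eqI) (simp add: res_ring mod_mult_left_eq)
  show "a + b + c = a + (b + c)"
    by (rule z2_eqI) (simp add: res_ring mod_add_left_eq mod_add_right_eq add.assoc)
  show "a + b = b + a"
    by (rule z2_eqI) (simp add: res_ring add.commute)
  show "0 + a = a"
    by (rule z2_eqI) (simp add: res_ring)
  show "- a + a = 0"
    by (rule z2_eqI) (simp add: res_ring mod_add_left_eq)
  show "a - b = a + - b"
    by (rule z2_eqI) (simp add: res_ring mod_add_right_eq)
  show "(a + b) * c = a * c + b * c"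
    by (rule z2_eqI) (simp add: res_ring mod_mult_left_eq mod_add_eq distrib_right)
  have "res 0 1 \<noteq> res 1 1" by (simp add: res_ring)
  then show "(0 :: z2) \<noteq> 1" by metis
qed

end

lemma res_le: "m \<le> n \<Longrightarrow> res x n mod 2 ^ m = res x m"
proof (induction n rule: dec_induct)
  case base
  show ?case by (rule res_mod)
next
  case (step n)
  have "res x (Suc n) mod 2 ^ m = (res x (Suc n) mod 2 ^ n) mod 2 ^ m"
    using step by (simp add: mod_mod_cancel le_imp_power_dvd)
  then show ?case using step by (simp add: res_Suc)
qed

lemma res_of_nat: "res (of_nat m) n = int m mod 2 ^ n"
proof (induction m)
  case 0
  show ?case by (simp add: zero_z2.rep_eq)
next
  case (Suc m)
  then show ?case by (cases "n = 0") (simp_all add: res_ring mod_add_right_eq)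
qed

lemma res_of_int: "res (of_int m) n = m mod 2 ^ n"
  by (cases m rule: int_diff_cases) (simp add: minus_z2.rep_eq res_of_nat mod_diff_eq)

lemma pow2_dvd_iff: "(2 :: z2) ^ n dvd x \<longleftrightarrow> res x n = 0"
proof
  assume "2 ^ n dvd x"
  then obtain y where "x = of_int (2 ^ n) * y" by auto
  then show "res x n = 0" by (simp add: times_z2.rep_eq res_of_int del: of_int_power)
next
  assume x: "res x n = 0"
  define a where "a m = res x (m + n) div 2 ^ n" for m
  have d: "2 ^ n dvd res x (m + n)" for m
    using res_le [of n "m + n" x] x by (simp add: dvd_eq_mod_eq_0)
  have "a m = a (Suc m) mod 2 ^ m" for m
  proof -
    have "a m * 2 ^ n = res x (Suc m + n) mod 2 ^ (m + n)"
      using d by (simp add: a_def res_Suc)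
    also have "\<dots> = (a (Suc m) * 2 ^ n) mod (2 ^ m * 2 ^ n)"
      using d [of "Suc m"] by (simp add: a_def power_add)
    also have "\<dots> = (a (Suc m) mod 2 ^ m) * 2 ^ n"
      by (simp add: mult_mod_left)
    finally show ?thesis by simp
  qed
  then have r: "res (Abs_z2 a) = a" by (intro Abs_z2_inverse CollectI allI)
  have "x = of_int (2 ^ n) * Abs_z2 a"
  proof (rule z2_eqI)
    fix m
    have "res (of_int (2 ^ n) * Abs_z2 a) m = (2 ^ n * a m) mod 2 ^ m"
      by (simp add: times_z2.rep_eq res_of_int r mod_mult_left_eq del: of_int_power)
    also have "2 ^ n * a m = res x (m + n)"
      using d by (simp add: a_def)
    finally show "res x m = res (of_int (2 ^ n) * Abs_z2 a) m"
      using res_le [of m "m + n" x] by simp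
  qed
  then show "2 ^ n dvd x" by (metis dvd_triv_left of_int_power of_int_numeral)
qed

lemma pow2_dvd_diff_iff: "(2 :: z2) ^ n dvd x - y \<longleftrightarrow> res x n = res y n"
  unfolding pow2_dvd_iff minus_z2.rep_eq
  by (metis res_mod mod_eq_dvd_iff dvd_eq_mod_eq_0)

lemma z2_eq_iff: "x = y \<longleftrightarrow> (\<forall>n. (2 :: z2) ^ n dvd x - y)"
  by (auto simp: pow2_dvd_diff_iff intro: z2_eqI)

text \<open>The 2-adic metric.\<close>

definition val2 :: "z2 \<Rightarrow> nat" where
  "val2 x = (GREATEST n. 2 ^ n dvd x)"

lemma pow2_dvd_iff_val2:
  assumes "x \<noteq> 0"
  shows "2 ^ n dvd x \<longleftrightarrow> n \<le> val2 x"
proof -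
  obtain b where b: "\<not> 2 ^ b dvd x" using z2_eq_iff [of x 0] assms by auto
  have mono: "2 ^ j dvd x" if "2 ^ k dvd x" "j \<le> k" for j k
    using that by (meson dvd_trans le_imp_power_dvd)
  have bd: "\<forall>k. 2 ^ k dvd x \<longrightarrow> k \<le> b" using b mono nat_le_linear by blast
  have "2 ^ val2 x dvd x"
    unfolding val2_def by (rule GreatestI_nat [of _ 0 b]) (use bd in auto)
  moreover have "2 ^ n dvd x \<Longrightarrow> n \<le> val2 x"
    unfolding val2_def using bd by (intro Greatest_le_nat) auto
  ultimately show ?thesis using mono by blast
qed

instantiation z2 :: metric_space
begin

definition dist_z2 :: "z2 \<Rightarrow> z2 \<Rightarrow> real" where
  "dist_z2 x y = (if x = y then 0 else 1 / 2 ^ val2 (x - y))"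

definition uniformity_z2 :: "(z2 \<times> z2) filter" where
  "uniformity_z2 = (INF e\<in>{0 <..}. principal {(x, y). dist x y < e})"

definition open_z2 :: "z2 set \<Rightarrow> bool" where
  "open_z2 U = (\<forall>x\<in>U. \<forall>\<^sub>F (x', y) in uniformity. x' = x \<longrightarrow> y \<in> U)"

instance
proof
  fix x y z :: z2
  show "dist x y = 0 \<longleftrightarrow> x = y" by (simp add: dist_z2_def)
  have le: "dist a b \<le> 1 / 2 ^ n \<longleftrightarrow> 2 ^ n dvd a - b" for a b :: z2 and n
    by (auto simp: dist_z2_def pow2_dvd_iff_val2 field_simps)
  have sym: "2 ^ n dvd a - b \<longleftrightarrow> 2 ^ n dvd b - a" for a b :: z2 and n
    by (metis dvd_minus_iff minus_diff_eq)
  show "dist x y \<le> dist x z + dist y z"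
  proof (cases "x = z \<or> y = z")
    case True
    have "dist x y = dist y x" if "x \<noteq> y"
      using that le [of x y] le [of y x] sym [of _ x y]
      by (metis (no_types, lifting) dist_z2_def order_antisym order_refl)
    then show ?thesis using True by (auto simp: dist_z2_def)
  next
    case False
    define n where "n = min (val2 (x - z)) (val2 (y - z))"
    have "2 ^ n dvd x - z" "2 ^ n dvd y - z"
      using False by (auto simp: pow2_dvd_iff_val2 n_def)
    then have "2 ^ n dvd (x - z) - (y - z)" by (rule dvd_diff)
    then have "dist x y \<le> 1 / 2 ^ n" by (simp add: le)
    also have "\<dots> \<le> dist x z + dist y z"
      using False by (auto simp: dist_z2_def n_def min_def)
    finally show ?thesis .
  qed
qed (rule uniformity_z2_def open_z2_def)+

end

lemma dist_z2_le_iff: "dist x (y :: z2) \<le> 1 / 2 ^ n \<longleftrightarrow> res x n = res y n"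
  by (auto simp: dist_z2_def pow2_dvd_iff_val2 field_simps simp flip: pow2_dvd_diff_iff)

lemma tendsto_z2_iff:
  fixes x :: z2
  shows "f \<longlonglongrightarrow> x \<longleftrightarrow> (\<forall>n. \<forall>\<^sub>F m in sequentially. res (f m) n = res x n)"
proof
  assume L: "f \<longlonglongrightarrow> x"
  show "\<forall>n. \<forall>\<^sub>F m in sequentially. res (f m) n = res x n"
  proof
    fix n :: nat
    have "\<forall>\<^sub>F m in sequentially. dist (f m) x < 1 / 2 ^ n"
      by (rule tendstoD [OF L]) simp
    then show "\<forall>\<^sub>F m in sequentially. res (f m) n = res x n"
      by eventually_elim (simp flip: dist_z2_le_iff)
  qed
next
  assume R: "\<forall>n. \<forall>\<^sub>F m in sequentially. res (f m) n = res x n"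
  show "f \<longlonglongrightarrow> x"
  proof (rule tendstoI)
    fix e :: real
    assume "e > 0"
    then obtain n where n: "(1 / 2) ^ n < e"
      using real_arch_pow_inv [of e "1 / 2"] by auto
    from R have "\<forall>\<^sub>F m in sequentially. res (f m) n = res x n" by blast
    then show "\<forall>\<^sub>F m in sequentially. dist (f m) x < e"
      by eventually_elim (use n in \<open>simp add: power_one_over flip: dist_z2_le_iff\<close>)
  qed
qed

text \<open>The digits \<open>r k\<close> of a 2-adic integer, and the lemmas identifying them by the 2-adic series.\<close>

definition digit :: "z2 \<Rightarrow> nat \<Rightarrow> int" where
  "digit x k = res x (Suc k) div 2 ^ k"

lemma digit_cases: "digit x k \<in> {0, 1}"
proof -
  have "0 \<le> digit x k"
    using res_bounds(1) [of x "Suc k"] by (simp add: digit_def pos_imp_zdiv_nonneg_iff)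
  moreover have "digit x k < 2"
  proof (rule ccontr)
    assume "\<not> digit x k < 2"
    then have "2 * 2 ^ k \<le> digit x k * 2 ^ k" by (intro mult_right_mono) auto
    also have "\<dots> \<le> res x (Suc k)"
      unfolding digit_def by (metis add_le_same_cancel1 div_mult_mod_eq le_add_same_cancel1
          pos_mod_sign zero_less_numeral zero_less_power)
    finally show False using res_bounds(2) [of x "Suc k"] by simp
  qed
  ultimately have "0 \<le> digit x k" "digit x k < 2" by auto
  then show ?thesis by auto
qed

lemma res_Suc_digit: "res x (Suc k) = res x k + digit x k * 2 ^ k"
  by (metis digit_def div_mult_mod_eq res_Suc add.commute)

lemma res_eq_sum_digits: "res x n = (\<Sum>k<n. digit x k * 2 ^ k)"
proof (induction n)
  case 0
  show ?case using res_bounds [of x 0] by simp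
next
  case (Suc n)
  then show ?case by (simp add: res_Suc_digit)
qed

lemma digits_sums: "(\<lambda>k. of_int (digit x k) * 2 ^ k) sums x"
  unfolding sums_def tendsto_z2_iff
proof
  fix n
  have "res (\<Sum>k<m. of_int (digit x k) * 2 ^ k) n = res x n" if "n \<le> m" for m
  proof -
    have "(\<Sum>k<m. of_int (digit x k) * 2 ^ k) = (of_int (res x m) :: z2)"
      by (simp add: res_eq_sum_digits)
    then show ?thesis using that by (simp add: res_of_int res_le)
  qed
  then show "\<forall>\<^sub>F m in sequentially. res (\<Sum>k<m. of_int (digit x k) * 2 ^ k) n = res x n"
    by (auto simp: eventually_sequentially)
qed

lemma sums_digit_z2:
  assumes "\<And>k. r k \<in> {0, 1 :: int}"
  shows "\<exists>x :: z2. (\<lambda>k. of_int (r k) * 2 ^ k) sums x \<and> digit x = r"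
proof -
  define a where "a n = (\<Sum>k<n. r k * 2 ^ k)" for n
  have bd: "0 \<le> a n \<and> a n < 2 ^ n" for n
  proof (induction n)
    case (Suc n)
    then show ?case using assms [of n] by (auto simp: a_def)
  qed (simp add: a_def)
  have "a n = a (Suc n) mod 2 ^ n" for n
    using bd [of n] by (simp add: a_def)
  then have r: "res (Abs_z2 a) = a" by (intro Abs_z2_inverse CollectI allI)
  have "digit (Abs_z2 a) k = r k" for k
    using bd [of k] by (simp add: digit_def r) (simp add: a_def)
  then show ?thesis using digits_sums [of "Abs_z2 a"] by auto
qed

lemma digit_unique:
  assumes "\<And>k. r k \<in> {0, 1 :: int}" "(\<lambda>k. of_int (r k) * 2 ^ k) sums (x :: z2)"
  shows "digit x = r"
  using sums_digit_z2 [of r] assms sums_unique2 by blast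

definition M :: "z2 \<Rightarrow> real" where
  "M x = (\<Sum>k. of_int (digit x k) / 2 ^ k)"

lemma M_summable: "summable (\<lambda>k. of_int (digit x k) / 2 ^ k :: real)"
proof (rule summable_comparison_test)
  show "\<exists>N. \<forall>k\<ge>N. norm (of_int (digit x k) / 2 ^ k :: real) \<le> (1 / 2) ^ k"
  proof (intro exI allI impI)
    show "norm (of_int (digit x k) / 2 ^ k :: real) \<le> (1 / 2) ^ k" for k
      using digit_cases [of x k] by (auto simp: power_one_over)
  qed
qed simp

lemma M_range: "M x \<in> {0..2}"
proof -
  have d: "0 \<le> digit x k" "digit x k \<le> 1" for k
    using digit_cases [of x k] by auto
  have "M x \<le> (\<Sum>k. (1 / 2) ^ k)"
    unfolding M_def using d
    by (intro suminf_le M_summable summable_geometric)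
      (auto simp: power_one_over intro!: divide_right_mono)
  also have "\<dots> = (2 :: real)" by (simp add: suminf_geometric)
  finally show ?thesis
    unfolding M_def using d by (auto intro!: suminf_nonneg M_summable)
qed

text \<open>
  \<open>half x\<close> is meaningful for multiples of 2 only.  Evenness is written \<open>2 dvd x\<close>, since \<open>z2\<close> is not
  made an instance of \<open>semiring_parity\<close>.
\<close>

lemma half_unique:
  assumes "(2 :: z2) dvd x"
  shows "\<exists>!y. 2 * y = x"
proof -
  have inj: "y = z" if e: "2 * y = 2 * z" for y z :: z2
  proof (rule z2_eqI)
    fix n
    have "(2 * res y (Suc n)) mod 2 ^ Suc n = (2 * res z (Suc n)) mod 2 ^ Suc n"
      using arg_cong [OF e, of "\<lambda>x. res x (Suc n)"] res_of_int [of 2 "Suc n"]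
      by (cases "n = 0") (simp_all add: times_z2.rep_eq mod_mult_left_eq)
    then have "2 * (res y (Suc n) mod 2 ^ n) = 2 * (res z (Suc n) mod 2 ^ n)"
      by (simp only: mult_mod_right power_Suc)
    then show "res y n = res z n" by (simp add: res_Suc)
  qed
  then show ?thesis using assms by (metis dvdE)
qed

definition half :: "z2 \<Rightarrow> z2" where
  "half x = (THE y. 2 * y = x)"

lemma half_mult: "2 dvd x \<Longrightarrow> 2 * half x = x"
  unfolding half_def using half_unique by (rule theI')

lemma odd_three_plus_one:
  assumes "\<not> 2 dvd (x :: z2)"
  shows "2 dvd 3 * x + 1"
proof -
  have "res x 1 = 1" using assms res_bounds [of x 1] pow2_dvd_iff [of 1 x] by auto
  then have "res (3 * x + 1) 1 = 0"
    using res_of_int [of 3 1] by (simp add: plus_z2.rep_eq times_z2.rep_eq one_z2.rep_eq)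
  then show ?thesis using pow2_dvd_iff [of 1] by simp
qed

definition T :: "z2 \<Rightarrow> z2" where
  "T x = (if 2 dvd x then half x else half (3 * x + 1))"

definition parity_seq :: "z2 \<Rightarrow> nat \<Rightarrow> nat" where
  "parity_seq x k = (if 2 dvd (T ^^ k) x then 0 else 1)"

definition Q :: "z2 \<Rightarrow> z2" where
  "Q x = (\<Sum>k. of_nat (parity_seq x k) * 2 ^ k)"

lemma Q_sums: "(\<lambda>k. of_nat (parity_seq x k) * 2 ^ k) sums Q x"
  and digit_Q: "digit (Q x) k = int (parity_seq x k)"
proof -
  obtain y where y: "(\<lambda>k. of_nat (parity_seq x k) * 2 ^ k) sums y"
      "digit y = (\<lambda>k. int (parity_seq x k))"
    using sums_digit_z2 [of "\<lambda>k. int (parity_seq x k)"] by (force simp: parity_seq_def)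
  moreover have "Q x = y" unfolding Q_def using y(1) by (rule sums_unique [symmetric])
  ultimately show "(\<lambda>k. of_nat (parity_seq x k) * 2 ^ k) sums Q x"
    "digit (Q x) k = int (parity_seq x k)" by simp_all
qed

definition \<alpha> :: "nat \<Rightarrow> int" where
  "\<alpha> k = (- 1 - (- 2) ^ (k - 2)) mod 2 ^ k"

end

theory Submission
  imports Defs
begin

text \<open>
  Put \<open>Y = M \<circ> Q\<close>.  Then \<open>Y (2 * y) = Y y / 2\<close> and \<open>Y x = 1 + Y y / 2\<close> if \<open>x\<close> is odd and \<open>3 * x + 1 = 2 * y\<close>.
  As \<open>T x + 1 = 3 / 2 * (x + 1)\<close> for odd \<open>x\<close>, a number \<open>2 ^ j * u - 1\<close> makes \<open>j\<close> odd steps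
  to \<open>3 ^ j * u - 1\<close>.  With \<open>j = k - 2\<close> the congruence on \<open>r\<close> says \<open>r = 2 ^ j * u - 1\<close> where \<open>3 ^ j * u\<close> has the form
  \<open>4 * n - 1\<close>.  So \<open>r\<close> reaches \<open>4 * n - 2\<close> after \<open>j\<close> odd steps, while \<open>2 * r + 1\<close> reaches \<open>12 * n - 4\<close> after
  \<open>j + 1\<close> odd steps, and the next two parities are 0, 1 and 0, 0 respectively, after which both
  trajectories are at \<open>3 * n - 1\<close>.
\<close>

lemma res_double_add:
  assumes "b \<in> {0, 1}"
  shows "res (2 * x + of_int b) (Suc n) = 2 * res x n + b"
proof -
  have "res (2 * x + of_int b) (Suc n) = (2 * res x (Suc n) + b) mod (2 * 2 ^ n)"
    using res_of_int [of 2 "Suc n"]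
    by (simp add: plus_z2.rep_eq times_z2.rep_eq res_of_int mod_simps)
  also have "\<dots> = (2 * res x n + b) mod (2 * 2 ^ n)"
  proof -
    have "2 * res x (Suc n) mod (2 * 2 ^ n) = 2 * res x n mod (2 * 2 ^ n)"
      by (simp add: mod_mult_mult1 res_Suc)
    then show ?thesis by (metis mod_add_left_eq)
  qed
  also have "\<dots> = 2 * res x n + b"
    using res_bounds [of x n] assms by (intro mod_pos_pos_trivial) auto
  finally show ?thesis .
qed

lemma digit_double_add:
  assumes "b \<in> {0, 1}"
  shows "digit (2 * x + of_int b) 0 = b"
    and "digit (2 * x + of_int b) (Suc n) = digit x n"
proof -
  show "digit (2 * x + of_int b) 0 = b"
    using res_double_add [OF assms, of x 0] by (simp add: digit_def)
  \<comment> \<open>Division by \<open>2 ^ Suc n\<close> splits into division by 2, which drops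
    \<open>b\<close>, and division by \<open>2 ^ n\<close>.\<close>
  have "(2 * res x (Suc n) + b) div 2 = res x (Suc n)"
    using assms by auto
  then show "digit (2 * x + of_int b) (Suc n) = digit x n"
    unfolding digit_def res_double_add [OF assms]
    by (simp add: zdiv_zmult2_eq)
qed

text \<open>Serves both coordinates: the digit shift comes from doubling for \<open>M\<close> and
  from \<open>T\<close> for \<open>M \<circ> Q\<close>.\<close>

lemma M_step:
  assumes "\<And>n. digit x (Suc n) = digit y n"
  shows "M x = of_int (digit x 0) + M y / 2"
proof -
  have "M x = of_int (digit x 0) + (\<Sum>n. of_int (digit x (Suc n)) / 2 ^ Suc n)"
    unfolding M_def using suminf_split_head [OF M_summable, of x] by simp
  also have "(\<Sum>n. of_int (digit x (Suc n)) / 2 ^ Suc n) = (\<Sum>n. of_int (digit y n) / 2 ^ n / 2 :: real)"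
    by (simp add: assms mult.commute)
  also have "\<dots> = M y / 2"
    unfolding M_def by (rule suminf_divide [OF M_summable])
  finally show ?thesis .
qed

lemma M_double: "M (2 * x) = M x / 2"
  using M_step [of "2 * x" x] digit_double_add [of 0 x] by simp

lemma M_double_plus_1: "M (2 * x + 1) = 1 + M x / 2"
  using M_step [of "2 * x + 1" x] digit_double_add [of 1 x] by simp

lemma half_double: "half (2 * y) = y"
  by (metis half_mult half_unique dvd_triv_left)

lemma odd_double_minus_1: "\<not> 2 dvd 2 * (x :: z2) - 1"
proof
  assume "2 dvd 2 * x - 1"
  then have "2 dvd 2 * x - (2 * x - 1)" by (rule dvd_diff [OF dvd_triv_left])
  then have "(2 :: z2) dvd 1" by (simp only: diff_diff_eq2 add_diff_cancel_left')
  then show False using pow2_dvd_iff [of 1 1] by (simp add: one_z2.rep_eq)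
qed

text \<open>\<open>Q\<close> turns \<open>T\<close> into the digit shift, since the parity sequence
  of \<open>T x\<close> is that of \<open>x\<close> without its first term.\<close>

lemma M_Q_step: "M (Q x) = (if 2 dvd x then 0 else 1) + M (Q (T x)) / 2"
proof -
  have "digit (Q x) (Suc n) = digit (Q (T x)) n" for n
    by (simp add: digit_Q parity_seq_def funpow_swap1)
  then show ?thesis
    using M_step [of "Q x" "Q (T x)"] by (simp add: digit_Q parity_seq_def)
qed

lemma M_Q_double: "M (Q (2 * x)) = M (Q x) / 2"
  using M_Q_step [of "2 * x"] by (simp add: T_def half_double)

lemma M_Q_double_minus_1: "M (Q (2 * x - 1)) = 1 + M (Q (3 * x - 1)) / 2"
proof -
  have "3 * (2 * x - 1) + 1 = 2 * (3 * x - 1)" by (simp add: algebra_simps)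
  then have "T (2 * x - 1) = 3 * x - 1"
    using odd_double_minus_1 [of x] half_double unfolding T_def by presburger
  then show ?thesis
    using M_Q_step [of "2 * x - 1"] odd_double_minus_1 [of x] by simp
qed

text \<open>Each odd step trades a factor 2 before \<open>u\<close> for a 3; the \<open>j\<close>
  leading digits 1 add up to 1 + 1/2 + ... = 2 - 2 / 2^j.\<close>

lemma M_Q_pow2_minus_1:
  "M (Q (2 ^ j * u - 1)) = 2 - 2 / 2 ^ j + M (Q (3 ^ j * u - 1)) / 2 ^ j"
proof (induction j arbitrary: u)
  case (Suc j)
  have "M (Q (2 ^ Suc j * u - 1)) = 1 + M (Q (2 ^ j * (3 * u) - 1)) / 2"
    using M_Q_double_minus_1 [of "2 ^ j * u"] by (simp add: mult_ac)
  then show ?case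
    unfolding Suc.IH by (simp add: mult_ac diff_divide_distrib add_divide_distrib)
qed simp

lemma M_Q_four_minus_2: "M (Q (4 * n - 2)) = 1 / 2 + M (Q (3 * n - 1)) / 4"
  using M_Q_double [of "2 * n - 1"] M_Q_double_minus_1 [of n] by (simp add: algebra_simps)

lemma M_Q_twelve_minus_4: "M (Q (12 * n - 4)) = M (Q (3 * n - 1)) / 4"
  using M_Q_double [of "2 * (3 * n - 1)"] M_Q_double [of "3 * n - 1"]
  by (simp add: algebra_simps)

text \<open>The sign in (-2)^j is what gives -1 modulo 4: as -3 is 1 modulo 4, so is 3^j * (-1)^j =
  (-3)^j.\<close>

lemma congruent_alpha_decompose:
  fixes r :: z2
  assumes "2 ^ (j + 2) dvd r - of_int (\<alpha> (j + 2))"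
  obtains u n where "r = 2 ^ j * u - 1" and "3 ^ j * u = 4 * n - 1"
proof -
  have "2 ^ (j + 2) dvd \<alpha> (j + 2) - (- 1 - (- 2) ^ j)"
    by (simp add: \<alpha>_def flip: mod_eq_dvd_iff)
  then obtain q where "\<alpha> (j + 2) = - 1 - (- 2) ^ j + 2 ^ (j + 2) * q"
    by (auto simp: algebra_simps elim!: dvdE)
  then have a: "of_int (\<alpha> (j + 2)) = - 1 - (- 2) ^ j + 2 ^ (j + 2) * (of_int q :: z2)"
    by simp
  obtain c where "r - of_int (\<alpha> (j + 2)) = 2 ^ (j + 2) * c"
    using assms by (elim dvdE)
  then have r: "r = - 1 - (- 2) ^ j + 2 ^ (j + 2) * (of_int q + c)"
    using a by (simp add: algebra_simps)
  \<comment> \<open>This is r + 1 with the factor 2^j taken out.\<close>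
  define u where "u = 4 * (of_int q + c) - (- 1) ^ j"
  have "(- 2 :: z2) ^ j = 2 ^ j * (- 1) ^ j" by (simp flip: power_mult_distrib)
  then have "r = 2 ^ j * u - 1"
    using r by (simp add: u_def algebra_simps)
  moreover have "(4 :: z2) dvd (- 3) ^ j - 1"
  proof (induction j)
    case (Suc j)
    have "(- 3 :: z2) ^ Suc j - 1 = - 3 * ((- 3) ^ j - 1) - 4" by (simp add: algebra_simps)
    then show ?case using Suc by (metis dvd_diff dvd_mult dvd_refl)
  qed simp
  then obtain e where "(- 3 :: z2) ^ j - 1 = 4 * e" by (elim dvdE)
  then have e: "(- 3 :: z2) ^ j = 4 * e + 1" by (simp add: algebra_simps)
  have "(3 :: z2) ^ j * (- 1) ^ j = 4 * e + 1" using e by (simp flip: power_mult_distrib)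
  then have "3 ^ j * u = 4 * (3 ^ j * (of_int q + c) - e) - 1"
    by (simp add: u_def algebra_simps)
  ultimately show thesis by (rule that)
qed

lemma M_Q_double_plus_1:
  assumes "2 ^ (j + 2) dvd r - of_int (\<alpha> (j + 2))"
  shows "M (Q (2 * r + 1)) = M (Q r) / 2 + (1 - 1 / 2 ^ (j + 2))"
proof -
  obtain u n where r: "r = 2 ^ j * u - 1" and u: "3 ^ j * u = 4 * n - 1"
    using assms by (rule congruent_alpha_decompose)
  have "M (Q r) = 2 - 2 / 2 ^ j + M (Q (4 * n - 2)) / 2 ^ j"
    unfolding r M_Q_pow2_minus_1 u by simp
  then have "M (Q r) = 2 - 2 / 2 ^ j + (1 / 2 + M (Q (3 * n - 1)) / 4) / 2 ^ j"
    by (simp add: M_Q_four_minus_2)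
  \<comment> \<open>The same \<open>u\<close> serves \<open>2 * r + 1\<close>, with exponent
    \<open>Suc j\<close>.\<close>
  moreover have "M (Q (2 * r + 1)) = 2 - 2 / 2 ^ Suc j + M (Q (3 * n - 1)) / 4 / 2 ^ Suc j"
  proof -
    have "2 * r + 1 = 2 ^ Suc j * u - 1" by (simp add: r algebra_simps)
    moreover have "3 ^ Suc j * u - 1 = 12 * n - 4"
      using arg_cong [OF u, of "\<lambda>x. 3 * x - 1"] by (simp add: algebra_simps)
    ultimately show ?thesis by (simp only: M_Q_pow2_minus_1 M_Q_twelve_minus_4)
  qed
  \<comment> \<open>The tails from \<open>3 * n - 1\<close> cancel. The leading ones differ by 1,
    and the digit 1 of \<open>Q r\<close> at position j + 1, halved, accounts for 1 / 2^(j +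
    2).\<close>
  ultimately show ?thesis by (simp only:) (simp add: field_simps)
qed

theorem theorem7:
  fixes X Y :: "z2 \<Rightarrow> real"
  assumes "X = M" and "Y = M \<circ> Q"
  shows "(\<forall>r. (X (2 * r), Y (2 * r)) = (1 / 2) *\<^sub>R (X r, Y r)) \<and>
    (\<forall>k r. k \<ge> 2 \<longrightarrow> 2 ^ k dvd r - of_int (\<alpha> k) \<longrightarrow>
      (X (2 * r + 1), Y (2 * r + 1)) = (1 / 2) *\<^sub>R (X r, Y r) + (1, 1 - 1 / 2 ^ k))"
proof (intro conjI allI impI)
  show "(X (2 * r), Y (2 * r)) = (1 / 2) *\<^sub>R (X r, Y r)" for r
    by (simp add: assms M_double M_Q_double)
next
  fix k :: nat and r :: z2
  assume "k \<ge> 2" and d: "2 ^ k dvd r - of_int (\<alpha> k)"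
  then obtain j where "k = j + 2" by (metis le_add_diff_inverse2)
  then show "(X (2 * r + 1), Y (2 * r + 1)) = (1 / 2) *\<^sub>R (X r, Y r) + (1, 1 - 1 / 2 ^ k)"
    using M_Q_double_plus_1 [of j r] d by (simp add: assms M_double_plus_1)
qed

end
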